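(* Let $m,n\ge 3$ be integers, let $k\in\mathbb{Z}_n^{\times}$ with $k^m\equiv 1 \pmod n$, let $\alpha$ be the order of $k$ in $\mathbb{Z}_n^{\times}$, and let $t=m/\alpha$. Let $A=(A_{ij})_{0\le i,j\le n-1}$ be the adjacency matrix of the Cayley graph $\mathcal{T}_{m,n,k}$ with respect to the packet ordering of the vertices, divided into $m\times m$ blocks $A_{ij}$ (rows indexed by the packet $V_i$, columns by the packet $V_j$). Then $A$ is block-circulant (i.e. $A_{ij}=A_{i+1,j+1}$ with block indices read modulo $n$), $A_{ii}=A(C_m)$ for each $i$, where $A(C_m)$ is the adjacency matrix of the $m$-cycle graph $C_m$ with its vertices $0,1,\dots,m-1$ in cyclic order, and for each $j\ne i$ the block $A_{ij}$ is a diagonal matrix with $0$, $t$ or $2t$ nonzero entries, given as follows. (i) If $k^s\not\equiv -1\pmod n$ for every $s$, then $$A_{ij}=\begin{cases}\mathrm{Diag}_m(\xi,\xi+\alpha,\dots,\xi+(t-1)\alpha), & \text{if } j\equiv i\pm k^{\alpha-\xi}\pmod n \text{ for some } 0\le\xi\le\alpha-1,\\ \Theta, & \text{otherwise.}\end{cases}$$ (ii) If $\alpha$ is even and $k^{\alpha/2}\equiv -1\pmod n$, then $$A_{ij}=\begin{cases}\mathrm{Diag}_m\left(\xi,\xi+\tfrac{\alpha}{2},\dots,\xi+(2t-1)\tfrac{\alpha}{2}\right), & \text{if } j\equiv i\pm k^{\alpha-\xi}\pmod n\text{ for some } 0\le\xi\le\tfrac{\alpha}{2}-1,\\ \Theta,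 & \text{otherwise.}\end{cases}$$
   Context: The group $\mathbb{Z}_m\ltimes_k\mathbb{Z}_n$ is $\langle x,y : x^m=1=y^n,\ x^{-1}yx=y^k\rangle$, of order $mn$; every element is uniquely $x^ay^b$ with $a\in\mathbb{Z}_m$, $b\in\mathbb{Z}_n$. The graph $\mathcal{T}_{m,n,k}$ is the undirected Cayley graph of this group with respect to $\{x^{\pm1},y^{\pm1}\}$ (written $\{(\pm1,0),(0,\pm1)\}$ in coordinates): $v_1,v_2$ are adjacent iff $v_2=v_1x^{\pm1}$ or $v_2=v_1y^{\pm1}$. Packets: for $i\in\{0,\dots,n-1\}$, $V_i=\{x^{\tau\alpha+\xi}y^{ik^{\xi}} : 0\le\tau\le t-1,\ 0\le\xi\le\alpha-1\}$. The $V_i$ partition the vertex set and $|V_i|=m$. Packet ordering: within $V_i$, $x^{\tau\alpha+\xi}y^{ik^{\xi}}<x^{\tau'\alpha+\xi'}y^{ik^{\xi'}}$ iff $\tau<\tau'$, or $\tau=\tau'$ and $\xi<\xi'$; for $i\neq j$, every vertex of $V_i$ precedes every vertex of $V_j$ iff $i<j$. Thus the vertex $x^{\tau\alpha+\xi}y^{ik^\xi}$ has position $\tau\alpha+\xi\in\{0,\dots,m-1\}$ in $V_i$. $\mathrm{Diag}_m(p_1,\dots,p_r)$ is the $m\times m$ diagonal matrix, rows and columns indexed by $0,\dots,m-1$, with diagonal entry $1$ at the positions $p_1,\dots,p_r$ and $0$ elsewhere. $\Theta$ is the zero matrix. *)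

theory Defs
  imports
    "HOL-Number_Theory.Number_Theory"
    "HOL-Algebra.Algebra"
    "Graph_Theory.Graph_Theory"
    "Jordan_Normal_Form.DL_Submatrix"
begin

section \<open>Groups given by a presentation\<close>

text \<open>
  A word is a list of letters \<open>(g, b)\<close>, where \<open>(g, True)\<close> stands for the generator \<open>g\<close> and
  \<open>(g, False)\<close> for its formal inverse. Two words represent the same element of the presented
  group iff they are connected by insertions and deletions of relators and of subwords
  \<open>g g\<^sup>-\<^sup>1\<close>, \<open>g\<^sup>-\<^sup>1 g\<close>.
\<close>

type_synonym 'g word = "('g \<times> bool) list"

inductive word_step :: "'g word set \<Rightarrow> 'g word \<Rightarrow> 'g word \<Rightarrow> bool" for R where
  cancel: "word_step R (u @ [(g, b), (g, \<not> b)] @ v) (u @ v)"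
| relator: "r \<in> R \<Longrightarrow> word_step R (u @ r @ v) (u @ v)"

definition word_rel :: "'g word set \<Rightarrow> ('g word \<times> 'g word) set" where
  "word_rel R = {(u, v). equivclp (word_step R) u v}"

definition word_class :: "'g word set \<Rightarrow> 'g word \<Rightarrow> 'g word set" where
  "word_class R w = word_rel R `` {w}"

definition presented_group :: "'g word set \<Rightarrow> 'g word set monoid" where
  "presented_group R =
    \<lparr>carrier = UNIV // word_rel R,
     mult = (\<lambda>A B. \<Union>u\<in>A. \<Union>v\<in>B. word_class R (u @ v)),
     one = word_class R []\<rparr>"

lemma equiv_word_rel: "equiv UNIV (word_rel R)"
  unfolding word_rel_def by (simp add: equivp_equiv)

lemma word_class_eq_iff: "word_class R u = word_class R v \<longleftrightarrow> equivclp (word_step R) u v"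
  using eq_equiv_class_iff[OF equiv_word_rel, of u v R]
  by (simp add: word_class_def word_rel_def)

lemma word_step_context:
  assumes "word_step R u v" shows "word_step R (a @ u @ b) (a @ v @ b)"
  using assms
proof cases
  case (cancel u' g c v')
  then show ?thesis using word_step.cancel[of R "a @ u'" g c "v' @ b"] by simp
next
  case (relator r u' v')
  then show ?thesis using word_step.relator[of r R "a @ u'" "v' @ b"] by simp
qed

lemma equivclp_word_step_context:
  assumes "equivclp (word_step R) u v"
  shows "equivclp (word_step R) (a @ u @ b) (a @ v @ b)"
  using assms
proof (induction rule: equivclp_induct)
  case base
  show ?case by simp
next
  case (step v w)
  from step.hyps(2)
  have "word_step R (a @ v @ b) (a @ w @ b) \<or> word_step R (a @ w @ b) (a @ v @ b)"
    by (blast intro: word_step_context)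
  with step.IH show ?case by (rule equivclp_into_equivclp)
qed

lemma equivclp_word_step_append:
  assumes "equivclp (word_step R) u u'" "equivclp (word_step R) v v'"
  shows "equivclp (word_step R) (u @ v) (u' @ v')"
proof -
  have "equivclp (word_step R) (u @ v) (u' @ v)"
    using equivclp_word_step_context[OF assms(1), of "[]" v] by simp
  moreover have "equivclp (word_step R) (u' @ v) (u' @ v')"
    using equivclp_word_step_context[OF assms(2), of u' "[]"] by simp
  ultimately show ?thesis by (rule equivclp_trans)
qed

lemma carrier_presented_group: "carrier (presented_group R) = range (word_class R)"
  by (auto simp: presented_group_def quotient_def word_class_def)

lemma one_presented_group: "\<one>\<^bsub>presented_group R\<^esub> = word_class R []"
  by (simp add: presented_group_def)

lemma mult_presented_group:
  "word_class R u \<otimes>\<^bsub>presented_group R\<^esub> word_class R v = word_class R (u @ v)"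
proof -
  have self: "w \<in> word_class R w" for w
    by (simp add: word_class_def word_rel_def)
  have "word_class R (u' @ v') = word_class R (u @ v)"
    if "u' \<in> word_class R u" "v' \<in> word_class R v" for u' v'
  proof -
    have "equivclp (word_step R) u u'" "equivclp (word_step R) v v'"
      using that by (auto simp: word_class_def word_rel_def)
    then have "equivclp (word_step R) (u @ v) (u' @ v')"
      by (rule equivclp_word_step_append)
    then show ?thesis unfolding word_class_eq_iff by (rule equivclp_sym)
  qed
  then have "(\<Union>u'\<in>word_class R u. \<Union>v'\<in>word_class R v. word_class R (u' @ v')) =
      (\<Union>u'\<in>word_class R u. \<Union>v'\<in>word_class R v. word_class R (u @ v))"
    by (intro SUP_cong refl)
  also have "\<dots> = word_class R (u @ v)"
    using self[of u] self[of v] by blast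
  finally show ?thesis by (simp add: presented_group_def)
qed

lemma group_presented_group: "group (presented_group R)"
proof (rule groupI)
  fix x assume "x \<in> carrier (presented_group R)"
  then obtain u where u: "x = word_class R u" by (auto simp: carrier_presented_group)
  let ?inv = "\<lambda>w. rev (map (\<lambda>(g, b). (g, \<not> b)) w)"
  have "equivclp (word_step R) (?inv w @ w) []" for w
  proof (induction w)
    case Nil
    show ?case by simp
  next
    case (Cons l w)
    obtain g b where l: "l = (g, b)" by force
    have "word_step R (?inv w @ [(g, \<not> b), (g, \<not> \<not> b)] @ w) (?inv w @ w)"
      by (rule word_step.cancel)
    then have "equivclp (word_step R) (?inv (l # w) @ l # w) (?inv w @ w)"
      by (intro r_into_equivclp) (simp add: l)
    with Cons.IH show ?case by (rule equivclp_trans[rotated])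
  qed
  then have "word_class R (?inv u) \<otimes>\<^bsub>presented_group R\<^esub> x = \<one>\<^bsub>presented_group R\<^esub>"
    unfolding u mult_presented_group one_presented_group word_class_eq_iff .
  then show "\<exists>y\<in>carrier (presented_group R). y \<otimes>\<^bsub>presented_group R\<^esub> x = \<one>\<^bsub>presented_group R\<^esub>"
    by (auto simp: carrier_presented_group)
qed (auto simp: carrier_presented_group one_presented_group mult_presented_group)


section \<open>The group and its Cayley graph\<close>

datatype gens = Gen_x | Gen_y

text \<open>
  \<open>x\<^sup>-\<^sup>1yx = y\<^sup>k\<close> becomes the relator \<open>x\<^sup>-\<^sup>1yxy\<^sup>-\<^sup>k\<close>. The residue class \<open>k\<close> modulo \<open>n\<close> is
  represented by an arbitrary natural number.
\<close>

definition semidirect_relators :: "nat \<Rightarrow> nat \<Rightarrow> nat \<Rightarrow> gens word set" where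
  "semidirect_relators m n k =
    {replicate m (Gen_x, True),
     replicate n (Gen_y, True),
     [(Gen_x, False), (Gen_y, True), (Gen_x, True)] @ replicate k (Gen_y, False)}"

definition semidirect_group :: "nat \<Rightarrow> nat \<Rightarrow> nat \<Rightarrow> gens word set monoid" where
  "semidirect_group m n k = presented_group (semidirect_relators m n k)"

definition elem_x :: "nat \<Rightarrow> nat \<Rightarrow> nat \<Rightarrow> gens word set" where
  "elem_x m n k = word_class (semidirect_relators m n k) [(Gen_x, True)]"

definition elem_y :: "nat \<Rightarrow> nat \<Rightarrow> nat \<Rightarrow> gens word set" where
  "elem_y m n k = word_class (semidirect_relators m n k) [(Gen_y, True)]"

text \<open>
  Undirected graphs are represented by symmetric sets of arcs; the arcs of a Cayley graph are
  symmetric whenever the connection set \<open>S\<close> is closed under inverses.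
\<close>

definition cayley_graph :: "('a, 'b) monoid_scheme \<Rightarrow> 'a set \<Rightarrow> 'a pair_pre_digraph" where
  "cayley_graph G S =
    \<lparr>pverts = carrier G, parcs = {(v, v \<otimes>\<^bsub>G\<^esub> s) | v s. v \<in> carrier G \<and> s \<in> S}\<rparr>"

lemma cayley_graph_sym:
  assumes "group G" "S \<subseteq> carrier G" "\<And>s. s \<in> S \<Longrightarrow> inv\<^bsub>G\<^esub> s \<in> S"
  shows "sym (parcs (cayley_graph G S))"
proof (rule symI)
  interpret group G by fact
  fix v w assume "(v, w) \<in> parcs (cayley_graph G S)"
  then obtain s where s: "v \<in> carrier G" "s \<in> S" "w = v \<otimes>\<^bsub>G\<^esub> s"
    by (auto simp: cayley_graph_def)
  then have "w \<in> carrier G" "w \<otimes>\<^bsub>G\<^esub> inv\<^bsub>G\<^esub> s = v"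
    using assms(2) by (auto simp: m_assoc)
  with assms(3)[OF s(2)] show "(w, v) \<in> parcs (cayley_graph G S)"
    unfolding cayley_graph_def by fastforce
qed

definition graph_T :: "nat \<Rightarrow> nat \<Rightarrow> nat \<Rightarrow> gens word set pair_pre_digraph" where
  "graph_T m n k =
    (let G = semidirect_group m n k; x = elem_x m n k; y = elem_y m n k
     in cayley_graph G {x, inv\<^bsub>G\<^esub> x, y, inv\<^bsub>G\<^esub> y})"

definition cycle_graph :: "nat \<Rightarrow> nat pair_pre_digraph" where
  "cycle_graph m =
    \<lparr>pverts = {..<m},
     parcs = {(u, v). u < m \<and> v < m \<and> (v = (u + 1) mod m \<or> u = (v + 1) mod m)}\<rparr>"


section \<open>Packets and the packet ordering\<close>

text \<open>The element \<open>x\<^bsup>\<tau>\<alpha>+\<xi>\<^esup> y\<^bsup>ik^\<xi>\<^esup>\<close>, where \<open>\<alpha> = ord n k\<close>.\<close>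

definition packet_elem :: "nat \<Rightarrow> nat \<Rightarrow> nat \<Rightarrow> nat \<Rightarrow> nat \<Rightarrow> nat \<Rightarrow> gens word set" where
  "packet_elem m n k i \<tau> \<xi> =
    (let G = semidirect_group m n k
     in (elem_x m n k [^]\<^bsub>G\<^esub> (\<tau> * ord n k + \<xi>)) \<otimes>\<^bsub>G\<^esub> (elem_y m n k [^]\<^bsub>G\<^esub> (i * k ^ \<xi>)))"

definition packet :: "nat \<Rightarrow> nat \<Rightarrow> nat \<Rightarrow> nat \<Rightarrow> gens word set set" where
  "packet m n k i = {packet_elem m n k i \<tau> \<xi> | \<tau> \<xi>. \<tau> < m div ord n k \<and> \<xi> < ord n k}"

definition packet_less :: "nat \<Rightarrow> nat \<Rightarrow> nat \<Rightarrow> gens word set \<Rightarrow> gens word set \<Rightarrow> bool" where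
  "packet_less m n k u v \<longleftrightarrow>
    (\<exists>i < n. \<exists>j < n. i < j \<and> u \<in> packet m n k i \<and> v \<in> packet m n k j) \<or>
    (\<exists>i < n. \<exists>\<tau> < m div ord n k. \<exists>\<tau>' < m div ord n k. \<exists>\<xi> < ord n k. \<exists>\<xi>' < ord n k.
       u = packet_elem m n k i \<tau> \<xi> \<and> v = packet_elem m n k i \<tau>' \<xi>' \<and>
       (\<tau> < \<tau>' \<or> \<tau> = \<tau>' \<and> \<xi> < \<xi>'))"


section \<open>Adjacency matrices and blocks\<close>

text \<open>
  The vertex at position \<open>p\<close>, counted from \<open>0\<close>, of a finite graph with respect to a strict total
  ordering \<open>prec\<close> of its vertices is the one with exactly \<open>p\<close> predecessors.
\<close>

definition vertex_at :: "'a pair_pre_digraph \<Rightarrow> ('a \<Rightarrow> 'a \<Rightarrow> bool) \<Rightarrow> nat \<Rightarrow> 'a" where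
  "vertex_at \<Gamma> prec p = (THE v. v \<in> pverts \<Gamma> \<and> card {u \<in> pverts \<Gamma>. prec u v} = p)"

definition adjacency_mat :: "'a pair_pre_digraph \<Rightarrow> ('a \<Rightarrow> 'a \<Rightarrow> bool) \<Rightarrow> int mat" where
  "adjacency_mat \<Gamma> prec =
    mat (card (pverts \<Gamma>)) (card (pverts \<Gamma>))
      (\<lambda>(p, q). if (vertex_at \<Gamma> prec p, vertex_at \<Gamma> prec q) \<in> parcs \<Gamma> then 1 else 0)"

definition block :: "nat \<Rightarrow> 'a mat \<Rightarrow> nat \<Rightarrow> nat \<Rightarrow> 'a mat" where
  "block m A i j = submatrix A {i * m ..< (i + 1) * m} {j * m ..< (j + 1) * m}"

definition block_circulant :: "nat \<Rightarrow> nat \<Rightarrow> 'a mat \<Rightarrow> bool" where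
  "block_circulant m n A \<longleftrightarrow>
    (\<forall>i < n. \<forall>j < n. block m A i j = block m A ((i + 1) mod n) ((j + 1) mod n))"

definition Diag :: "nat \<Rightarrow> nat set \<Rightarrow> int mat" where
  "Diag m P = mat m m (\<lambda>(p, q). if p = q \<and> p \<in> P then 1 else 0)"

definition nonzero_entries :: "'a::zero mat \<Rightarrow> (nat \<times> nat) set" where
  "nonzero_entries B = {(p, q). p < dim_row B \<and> q < dim_col B \<and> B $$ (p, q) \<noteq> 0}"

end

theory Submission
  imports Defs
begin

text \<open>
  Words act on pairs of exponents modulo \<open>m\<close> and \<open>n\<close> as right multiplication acts on \<open>x\<^sup>a y\<^sup>b\<close>. The
  relators act trivially, so the \<open>mn\<close> normal forms are pairwise distinct. Since \<open>k\<^sup>\<alpha> = 1\<close>, the vertex at position \<open>p\<close> of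
  the packet \<open>i\<close> is \<open>x\<^sup>p y\<^bsup>ik^p\<^esup>\<close>. Multiplication by \<open>x\<close> moves it to position \<open>p + 1\<close> of the same
  packet, and multiplication by \<open>y\<close> moves it to position \<open>p\<close> of the packet \<open>j\<close> with
  \<open>(j - i) k\<^sup>p = 1\<close>. So an off-diagonal block is diagonal, its nonzero positions being the \<open>p\<close> with
  \<open>(j - i) k\<^sup>p = \<plusminus>1\<close>. If one of them is \<open>\<xi>\<close>, then the others are the \<open>p\<close> with \<open>k\<^sup>p = \<plusminus>k\<^sup>\<xi>\<close>, a
  residue class modulo \<open>\<alpha>\<close> or \<open>\<alpha> / 2\<close> according to whether \<open>-1\<close> is a power of \<open>k\<close>.
\<close>

section \<open>Normal forms in the group\<close>

text \<open>
  A letter acts on the exponents of a normal form \<open>x\<^sup>a y\<^sup>b\<close> by right multiplication; the exponents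
  \<open>m - 1\<close> and \<open>n - 1\<close> stand for \<open>-1\<close>.
\<close>

fun letter_act :: "nat \<Rightarrow> nat \<Rightarrow> nat \<Rightarrow> gens \<times> bool \<Rightarrow> nat \<times> nat \<Rightarrow> nat \<times> nat" where
  "letter_act m n k (Gen_x, True) (a, b) = (Suc a mod m, k * b mod n)"
| "letter_act m n k (Gen_x, False) (a, b) = ((a + (m - 1)) mod m, k ^ (m - 1) * b mod n)"
| "letter_act m n k (Gen_y, True) (a, b) = (a, Suc b mod n)"
| "letter_act m n k (Gen_y, False) (a, b) = (a, (b + (n - 1)) mod n)"

text \<open>The congruence makes multiplication by \<open>k\<close> a bijection of the residues
  modulo \<open>n\<close> whose \<open>m\<close>-th power is the identity, as the relators require
  of the action of \<open>x\<close>.\<close>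

locale packet_group =
  fixes m n k :: nat
  assumes m_pos: "m > 0" and n_gt_1: "n > 1" and k_pow_m: "[k ^ m = 1] (mod n)"
begin

abbreviation R where "R \<equiv> semidirect_relators m n k"
abbreviation G where "G \<equiv> semidirect_group m n k"
abbreviation x where "x \<equiv> elem_x m n k"
abbreviation y where "y \<equiv> elem_y m n k"

text \<open>\<open>fold\<close> applies the leftmost letter first, in agreement with right
  multiplication.\<close>

definition word_act :: "gens word \<Rightarrow> nat \<times> nat \<Rightarrow> nat \<times> nat" where
  "word_act w = fold (letter_act m n k) w"

lemma word_act_simps [simp]:
  "word_act [] s = s"
  "word_act (l # w) s = word_act w (letter_act m n k l s)"
  "word_act (u @ v) s = word_act v (word_act u s)"
  by (simp_all add: word_act_def)

lemma letter_act_in: "s \<in> {..<m} \<times> {..<n} \<Longrightarrow> letter_act m n k l s \<in> {..<m} \<times> {..<n}"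
  using m_pos n_gt_1 by (cases "(m, n, k, l, s)" rule: letter_act.cases) auto

lemma word_act_in: "s \<in> {..<m} \<times> {..<n} \<Longrightarrow> word_act w s \<in> {..<m} \<times> {..<n}"
proof (induction w arbitrary: s)
  case (Cons l w)
  show ?case using Cons.IH[OF letter_act_in[OF Cons.prems, of l]] by simp
qed simp

lemma zero_in: "(0, 0) \<in> {..<m} \<times> {..<n}"
  using m_pos n_gt_1 by simp

text \<open>\<open>k ^ (m - 1)\<close> is the inverse of \<open>k\<close> modulo \<open>n\<close>,
  hence its use as the factor for the inverse of \<open>x\<close>.\<close>

lemma k_pow_pred: "[k ^ (m - 1) * (k * b) = b] (mod n)"
proof -
  have "k ^ m = k ^ (m - 1) * k"
    using m_pos by (cases m) simp_all
  with cong_scalar_right[OF k_pow_m, of b] show ?thesis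
    by (simp add: mult.assoc)
qed

text \<open>Every letter reduces the exponents it changes, so opposite letters undo each other on
  reduced pairs.\<close>

lemma letter_act_cancel:
  assumes "s \<in> {..<m} \<times> {..<n}"
  shows "letter_act m n k (g, \<not> b) (letter_act m n k (g, b) s) = s"
proof -
  obtain a c where s: "s = (a, c)" "a < m" "c < n" using assms by auto
  have "k ^ (m - 1) * (k * c) mod n = c" "k * (k ^ (m - 1) * c) mod n = c"
    using k_pow_pred[of c] s by (simp_all add: cong_def mult_ac)
  moreover have "(Suc a + (m - 1)) mod m = a" "Suc (a + (m - 1)) mod m = a"
    "(Suc c + (n - 1)) mod n = c" "Suc (c + (n - 1)) mod n = c"
    using s m_pos n_gt_1 by simp_all
  ultimately show ?thesis
    unfolding s by (cases g; cases b; simp add: mod_simps)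
qed

lemma word_act_replicate_x: "a < m \<Longrightarrow> b < n \<Longrightarrow>
    word_act (replicate r (Gen_x, True)) (a, b) = ((a + r) mod m, k ^ r * b mod n)"
proof (induction r arbitrary: a b)
  case (Suc r)
  then show ?case using m_pos n_gt_1 by (simp add: mod_simps mult_ac)
qed simp

lemma word_act_replicate_y: "a < m \<Longrightarrow> b < n \<Longrightarrow>
    word_act (replicate r (Gen_y, True)) (a, b) = (a, (b + r) mod n)"
proof (induction r arbitrary: b)
  case (Suc r)
  then show ?case using n_gt_1 by (simp add: mod_simps)
qed simp

lemma word_act_replicate_y_inv: "a < m \<Longrightarrow> b < n \<Longrightarrow>
    word_act (replicate r (Gen_y, False)) (a, b) = (a, (b + r * (n - 1)) mod n)"
proof (induction r arbitrary: b)
  case (Suc r)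
  \<comment> \<open>An opaque name for the exponent that stands for \<open>-1\<close> leaves only
    additions modulo \<open>n\<close>.\<close>
  define e where "e = n - 1"
  have "letter_act m n k (Gen_y, False) (a, b) = (a, (b + e) mod n)"
    by (simp add: e_def)
  then show ?case using Suc n_gt_1 unfolding e_def[symmetric]
    by (simp del: letter_act.simps add: mod_simps add.assoc)
qed simp

text \<open>The power relators come down to \<open>k ^ m = 1\<close> and to periodicity of the
  exponents. The conjugation relator sends \<open>b\<close> to
  \<open>k * (k ^ (m - 1) * b + 1) - k\<close>, which is \<open>b\<close> modulo
  \<open>n\<close>.\<close>

lemma word_act_relator:
  assumes r: "r \<in> R" and s: "s \<in> {..<m} \<times> {..<n}"
  shows "word_act r s = s"
proof -
  obtain a b where s: "s = (a, b)" and ab: "a < m" "b < n" using s by auto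
  have kb: "k ^ m * b mod n = b"
    using cong_scalar_right[OF k_pow_m, of b] ab by (simp add: cong_def)
  from r consider "r = replicate m (Gen_x, True)" | "r = replicate n (Gen_y, True)"
    | "r = [(Gen_x, False), (Gen_y, True), (Gen_x, True)] @ replicate k (Gen_y, False)"
    unfolding semidirect_relators_def by blast
  then show ?thesis
  proof cases
    case 1
    then show ?thesis using kb ab by (simp add: s word_act_replicate_x)
  next
    case 2
    then show ?thesis using ab by (simp add: s word_act_replicate_y)
  next
    case 3
    \<comment> \<open>The summand \<open>k * (n - 1)\<close> stands for \<open>-k\<close>: each of
      the \<open>k\<close> inverse letters adds \<open>n - 1\<close>.\<close>
    have "[k * Suc (k ^ (m - 1) * b) + k * (n - 1) = k ^ (m - 1) * (k * b) + k * n] (mod n)"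
      using n_gt_1 by (cases n) (simp_all add: algebra_simps)
    also have "[k ^ (m - 1) * (k * b) + k * n = b] (mod n)"
      using k_pow_pred[of b] by (simp add: cong_def)
    finally have "(k * Suc (k ^ (m - 1) * b) + k * (n - 1)) mod n = b"
      using ab by (simp add: cong_def)
    then have "(k * (Suc (k ^ (m - 1) * b mod n) mod n) mod n + k * (n - 1)) mod n = b"
      by (simp add: mod_simps)
    moreover have "Suc ((a + (m - 1)) mod m) mod m = a"
      using ab m_pos by (simp add: mod_simps)
    ultimately show ?thesis
      using 3 ab m_pos n_gt_1 by (simp add: s word_act_replicate_y_inv)
  qed
qed

lemma word_act_step:
  assumes "word_step R u v" "s \<in> {..<m} \<times> {..<n}"
  shows "word_act u s = word_act v s"
  using assms
proof cases
  case (cancel u' g b v')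
  then show ?thesis
    using letter_act_cancel[OF word_act_in[OF assms(2)], of g b u'] by simp
next
  case (relator r u' v')
  then show ?thesis using word_act_relator[OF relator(3) word_act_in[OF assms(2)]] by simp
qed

text \<open>The action is therefore well defined on group elements, which keeps distinct normal
  forms apart.\<close>

lemma word_act_equiv:
  "equivclp (word_step R) u v \<Longrightarrow> s \<in> {..<m} \<times> {..<n} \<Longrightarrow> word_act u s = word_act v s"
  by (induction rule: equivclp_induct) (auto dest: word_act_step)

section \<open>Computation in the presented group\<close>

lemma class_in [simp]: "word_class R w \<in> carrier G"
  by (simp add: semidirect_group_def carrier_presented_group)

lemma mult_class [simp]: "word_class R u \<otimes>\<^bsub>G\<^esub> word_class R v = word_class R (u @ v)"
  by (simp add: semidirect_group_def mult_presented_group)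

lemma group_G: "group G"
  by (simp add: semidirect_group_def group_presented_group)

lemma one_G: "\<one>\<^bsub>G\<^esub> = word_class R []"
  by (simp add: semidirect_group_def one_presented_group)

lemma class_relator: "r \<in> R \<Longrightarrow> word_class R (u @ r @ v) = word_class R (u @ v)"
  unfolding word_class_eq_iff by (intro r_into_equivclp word_step.relator)

lemma class_cancel: "word_class R (u @ [(g, b), (g, \<not> b)] @ v) = word_class R (u @ v)"
  unfolding word_class_eq_iff by (intro r_into_equivclp word_step.cancel)

lemma pow_class: "word_class R [l] [^]\<^bsub>G\<^esub> r = word_class R (replicate r l)" for r :: nat
proof -
  interpret G: group G by (rule group_G)
  show ?thesis
    by (induction r) (simp_all add: one_G replicate_append_same)
qed

lemma inv_class: "inv\<^bsub>G\<^esub> (word_class R [(g, True)]) = word_class R [(g, False)]"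
proof -
  interpret G: group G by (rule group_G)
  show ?thesis
    using class_cancel[of "[]" g False "[]"] by (intro G.inv_equality) (simp_all add: one_G)
qed

text \<open>The conjugation relator amounts to \<open>y x = x y^k\<close>, which moves
  \<open>x\<close> to the left past one factor \<open>y\<close> at a time.\<close>

lemma y_pow_x:
  "y [^]\<^bsub>G\<^esub> b \<otimes>\<^bsub>G\<^esub> x = x \<otimes>\<^bsub>G\<^esub> y [^]\<^bsub>G\<^esub> (k * b)" for b :: nat
proof -
  interpret G: group G by (rule group_G)
  have x: "x \<in> carrier G" and y: "y \<in> carrier G" by (simp_all add: elem_x_def elem_y_def)
  have "[(Gen_x, False), (Gen_y, True), (Gen_x, True)] @ replicate k (Gen_y, False) \<in> R"
    by (simp add: semidirect_relators_def)
  from class_relator[OF this, of "[]" "[]"]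
  have rel: "inv\<^bsub>G\<^esub> x \<otimes>\<^bsub>G\<^esub> y \<otimes>\<^bsub>G\<^esub> x \<otimes>\<^bsub>G\<^esub> (inv\<^bsub>G\<^esub> y) [^]\<^bsub>G\<^esub> k = \<one>\<^bsub>G\<^esub>"
    by (simp add: elem_x_def elem_y_def inv_class pow_class one_G)
  then have "inv\<^bsub>G\<^esub> x \<otimes>\<^bsub>G\<^esub> y \<otimes>\<^bsub>G\<^esub> x \<otimes>\<^bsub>G\<^esub> inv\<^bsub>G\<^esub> (y [^]\<^bsub>G\<^esub> k) = \<one>\<^bsub>G\<^esub>"
    using y by (simp add: G.nat_pow_inv)
  then have conj: "inv\<^bsub>G\<^esub> x \<otimes>\<^bsub>G\<^esub> y \<otimes>\<^bsub>G\<^esub> x = y [^]\<^bsub>G\<^esub> k"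
    using x y G.inv_equality by fastforce
  have "x \<otimes>\<^bsub>G\<^esub> (inv\<^bsub>G\<^esub> x \<otimes>\<^bsub>G\<^esub> y \<otimes>\<^bsub>G\<^esub> x) = y \<otimes>\<^bsub>G\<^esub> x"
    using x y by (simp add: G.m_assoc[symmetric])
  then have yx: "y \<otimes>\<^bsub>G\<^esub> x = x \<otimes>\<^bsub>G\<^esub> y [^]\<^bsub>G\<^esub> k"
    by (simp only: conj)
  show ?thesis
  proof (induction b)
    case (Suc b)
    have "y [^]\<^bsub>G\<^esub> Suc b \<otimes>\<^bsub>G\<^esub> x = y [^]\<^bsub>G\<^esub> b \<otimes>\<^bsub>G\<^esub> (x \<otimes>\<^bsub>G\<^esub> y [^]\<^bsub>G\<^esub> k)"
      using x y by (simp add: G.m_assoc yx)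
    also have "\<dots> = (y [^]\<^bsub>G\<^esub> b \<otimes>\<^bsub>G\<^esub> x) \<otimes>\<^bsub>G\<^esub> y [^]\<^bsub>G\<^esub> k"
      using x y by (simp add: G.m_assoc)
    also have "\<dots> = x \<otimes>\<^bsub>G\<^esub> (y [^]\<^bsub>G\<^esub> (k * b) \<otimes>\<^bsub>G\<^esub> y [^]\<^bsub>G\<^esub> k)"
      using x y by (simp add: Suc.IH G.m_assoc)
    finally show ?case using x y by (simp add: G.nat_pow_mult add.commute)
  qed (use x in simp)
qed

lemma x_pow_mod: "x [^]\<^bsub>G\<^esub> (a mod m) = x [^]\<^bsub>G\<^esub> a"
  and y_pow_mod: "y [^]\<^bsub>G\<^esub> (a mod n) = y [^]\<^bsub>G\<^esub> a" for a :: nat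
proof -
  interpret G: group G by (rule group_G)
  have pow: "z [^]\<^bsub>G\<^esub> (a mod r) = z [^]\<^bsub>G\<^esub> a"
    if "z \<in> carrier G" "z [^]\<^bsub>G\<^esub> r = \<one>\<^bsub>G\<^esub>" for z and r :: nat
  proof -
    have "z [^]\<^bsub>G\<^esub> a = z [^]\<^bsub>G\<^esub> (r * (a div r) + a mod r)" by simp
    also have "\<dots> = (z [^]\<^bsub>G\<^esub> r) [^]\<^bsub>G\<^esub> (a div r) \<otimes>\<^bsub>G\<^esub> z [^]\<^bsub>G\<^esub> (a mod r)"
      using that(1) by (simp only: G.nat_pow_mult[symmetric] G.nat_pow_pow)
    finally show ?thesis using that by simp
  qed
  have "replicate m (Gen_x, True) \<in> R" "replicate n (Gen_y, True) \<in> R"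
    by (simp_all add: semidirect_relators_def)
  from this[THEN class_relator, of "[]" "[]"]
  have "x [^]\<^bsub>G\<^esub> m = \<one>\<^bsub>G\<^esub>" "y [^]\<^bsub>G\<^esub> n = \<one>\<^bsub>G\<^esub>"
    by (simp_all add: elem_x_def elem_y_def pow_class one_G)
  then show "x [^]\<^bsub>G\<^esub> (a mod m) = x [^]\<^bsub>G\<^esub> a" "y [^]\<^bsub>G\<^esub> (a mod n) = y [^]\<^bsub>G\<^esub> a"
    by (simp_all add: pow elem_x_def elem_y_def)
qed

text \<open>Right multiplication of a normal form by one letter changes the exponents exactly as
  \<open>letter_act\<close> does, so the action on \<open>(0, 0)\<close> computes the normal form of
  a word.\<close>

lemma class_normal_form:
  "word_class R w = x [^]\<^bsub>G\<^esub> fst (word_act w (0, 0)) \<otimes>\<^bsub>G\<^esub> y [^]\<^bsub>G\<^esub> snd (word_act w (0, 0))"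
proof (induction w rule: rev_induct)
  case Nil
  interpret G: group G by (rule group_G)
  show ?case using G.l_one[OF G.one_closed] by (simp add: one_G)
next
  case (snoc l w)
  interpret G: group G by (rule group_G)
  have x: "x \<in> carrier G" and y: "y \<in> carrier G" by (simp_all add: elem_x_def elem_y_def)
  obtain a b where ab: "word_act w (0, 0) = (a, b)" by force
  have IH: "word_class R w = x [^]\<^bsub>G\<^esub> a \<otimes>\<^bsub>G\<^esub> y [^]\<^bsub>G\<^esub> b" using snoc.IH ab by simp
  \<comment> \<open>Stated for all powers of \<open>x\<close>, because the letter
    \<open>(Gen_x, False)\<close> is treated as the power \<open>m - 1\<close>.\<close>
  have xr: "x [^]\<^bsub>G\<^esub> a \<otimes>\<^bsub>G\<^esub> y [^]\<^bsub>G\<^esub> b \<otimes>\<^bsub>G\<^esub> x [^]\<^bsub>G\<^esub> r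
      = x [^]\<^bsub>G\<^esub> (a + r) \<otimes>\<^bsub>G\<^esub> y [^]\<^bsub>G\<^esub> (k ^ r * b)" for r :: nat
  proof (induction r)
    case (Suc r)
    have "x [^]\<^bsub>G\<^esub> a \<otimes>\<^bsub>G\<^esub> y [^]\<^bsub>G\<^esub> b \<otimes>\<^bsub>G\<^esub> x [^]\<^bsub>G\<^esub> Suc r
        = (x [^]\<^bsub>G\<^esub> a \<otimes>\<^bsub>G\<^esub> y [^]\<^bsub>G\<^esub> b \<otimes>\<^bsub>G\<^esub> x [^]\<^bsub>G\<^esub> r) \<otimes>\<^bsub>G\<^esub> x"
      using x y by (simp add: G.m_assoc)
    also have "\<dots> = x [^]\<^bsub>G\<^esub> (a + r) \<otimes>\<^bsub>G\<^esub> (y [^]\<^bsub>G\<^esub> (k ^ r * b) \<otimes>\<^bsub>G\<^esub> x)"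
      unfolding Suc.IH using x y by (simp add: G.m_assoc)
    also have "\<dots> = x [^]\<^bsub>G\<^esub> (a + Suc r) \<otimes>\<^bsub>G\<^esub> y [^]\<^bsub>G\<^esub> (k ^ Suc r * b)"
      unfolding y_pow_x using x y by (simp add: G.m_assoc[symmetric] mult.assoc)
    finally show ?case .
  qed (use x y in simp)
  have yr: "x [^]\<^bsub>G\<^esub> a \<otimes>\<^bsub>G\<^esub> y [^]\<^bsub>G\<^esub> b \<otimes>\<^bsub>G\<^esub> y [^]\<^bsub>G\<^esub> r
      = x [^]\<^bsub>G\<^esub> a \<otimes>\<^bsub>G\<^esub> y [^]\<^bsub>G\<^esub> (b + r)" for r :: nat
    using x y by (simp add: G.m_assoc G.nat_pow_mult)
  \<comment> \<open>The second premise says \<open>z^r = 1\<close>, in the form in which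
    \<open>x_pow_mod\<close> and \<open>y_pow_mod\<close> provide it.\<close>
  have inv: "inv\<^bsub>G\<^esub> z = z [^]\<^bsub>G\<^esub> (r - 1)"
    if "z \<in> carrier G" "z [^]\<^bsub>G\<^esub> (r mod r) = z [^]\<^bsub>G\<^esub> r" "r > 0" for z and r :: nat
  proof (rule G.inv_equality)
    have "z [^]\<^bsub>G\<^esub> (r - 1) \<otimes>\<^bsub>G\<^esub> z = z [^]\<^bsub>G\<^esub> Suc (r - 1)"
      by simp
    then show "z [^]\<^bsub>G\<^esub> (r - 1) \<otimes>\<^bsub>G\<^esub> z = \<one>\<^bsub>G\<^esub>" using that by simp
  qed (use that in auto)
  have l: "word_class R (w @ [l]) = x [^]\<^bsub>G\<^esub> a \<otimes>\<^bsub>G\<^esub> y [^]\<^bsub>G\<^esub> b \<otimes>\<^bsub>G\<^esub> word_class R [l]"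
    by (simp flip: IH)
  consider "l = (Gen_x, True)" | "l = (Gen_x, False)" | "l = (Gen_y, True)" | "l = (Gen_y, False)"
  proof -
    obtain g c where "l = (g, c)" by force
    then show thesis using that by (cases g; cases c) auto
  qed
  then show ?case
  proof cases
    case 1
    then have "word_class R [l] = x [^]\<^bsub>G\<^esub> (1 :: nat)" using x by (simp add: elem_x_def)
    then have "word_class R (w @ [l]) = x [^]\<^bsub>G\<^esub> (a + 1) \<otimes>\<^bsub>G\<^esub> y [^]\<^bsub>G\<^esub> (k ^ 1 * b)"
      unfolding l by (simp only: xr)
    also have "\<dots> = x [^]\<^bsub>G\<^esub> ((a + 1) mod m) \<otimes>\<^bsub>G\<^esub> y [^]\<^bsub>G\<^esub> (k ^ 1 * b mod n)"
      by (simp only: x_pow_mod y_pow_mod)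
    finally show ?thesis by (simp add: 1 ab)
  next
    case 2
    then have "word_class R [l] = x [^]\<^bsub>G\<^esub> (m - 1)"
      using inv[OF x x_pow_mod m_pos] by (simp add: elem_x_def inv_class)
    then have "word_class R (w @ [l]) = x [^]\<^bsub>G\<^esub> (a + (m - 1)) \<otimes>\<^bsub>G\<^esub> y [^]\<^bsub>G\<^esub> (k ^ (m - 1) * b)"
      unfolding l by (simp only: xr)
    also have "\<dots> = x [^]\<^bsub>G\<^esub> ((a + (m - 1)) mod m) \<otimes>\<^bsub>G\<^esub> y [^]\<^bsub>G\<^esub> (k ^ (m - 1) * b mod n)"
      by (simp only: x_pow_mod y_pow_mod)
    finally show ?thesis by (simp add: 2 ab)
  next
    case 3
    then have "word_class R [l] = y [^]\<^bsub>G\<^esub> (1 :: nat)" using y by (simp add: elem_y_def)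
    then have "word_class R (w @ [l]) = x [^]\<^bsub>G\<^esub> a \<otimes>\<^bsub>G\<^esub> y [^]\<^bsub>G\<^esub> (b + 1)"
      unfolding l by (simp only: yr)
    also have "\<dots> = x [^]\<^bsub>G\<^esub> a \<otimes>\<^bsub>G\<^esub> y [^]\<^bsub>G\<^esub> ((b + 1) mod n)"
      by (simp only: x_pow_mod y_pow_mod)
    finally show ?thesis by (simp add: 3 ab)
  next
    case 4
    then have "word_class R [l] = y [^]\<^bsub>G\<^esub> (n - 1)"
      using inv[OF y y_pow_mod] n_gt_1 by (simp add: elem_y_def inv_class)
    then have "word_class R (w @ [l]) = x [^]\<^bsub>G\<^esub> a \<otimes>\<^bsub>G\<^esub> y [^]\<^bsub>G\<^esub> (b + (n - 1))"
      unfolding l by (simp only: yr)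
    also have "\<dots> = x [^]\<^bsub>G\<^esub> a \<otimes>\<^bsub>G\<^esub> y [^]\<^bsub>G\<^esub> ((b + (n - 1)) mod n)"
      by (simp only: x_pow_mod y_pow_mod)
    finally show ?thesis by (simp add: 4 ab)
  qed
qed

text \<open>The image of \<open>(0, 0)\<close> is a complete invariant: invariance under the
  relators gives one direction, the normal form the other.\<close>

lemma class_eq_iff: "word_class R u = word_class R v \<longleftrightarrow> word_act u (0, 0) = word_act v (0, 0)"
proof
  show "word_class R u = word_class R v \<Longrightarrow> word_act u (0, 0) = word_act v (0, 0)"
    unfolding word_class_eq_iff by (rule word_act_equiv[OF _ zero_in])
  show "word_act u (0, 0) = word_act v (0, 0) \<Longrightarrow> word_class R u = word_class R v"
    unfolding class_normal_form by simp
qed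

end

section \<open>Enumerations and blocks of adjacency matrices\<close>

text \<open>The predecessors of \<open>f a\<close> are the images of the numbers below
  \<open>a\<close>, so \<open>f a\<close> has exactly \<open>a\<close> of them and the vertex with
  \<open>p\<close> predecessors is unique.\<close>

lemma vertex_at_enumeration:
  assumes bij: "bij_betw f {..<N} (pverts \<Gamma>)"
    and prec: "\<And>a b. a < N \<Longrightarrow> b < N \<Longrightarrow> prec (f a) (f b) \<longleftrightarrow> a < b"
    and p: "p < N"
  shows "vertex_at \<Gamma> prec p = f p"
proof -
  have inj: "inj_on f {..<N}" and im: "pverts \<Gamma> = f ` {..<N}"
    using bij by (auto simp: bij_betw_def)
  have card: "card {u \<in> pverts \<Gamma>. prec u (f a)} = a" if "a < N" for a
  proof -
    have "{u \<in> pverts \<Gamma>. prec u (f a)} = f ` {b. b < N \<and> prec (f b) (f a)}"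
      unfolding im by blast
    also have "{b. b < N \<and> prec (f b) (f a)} = {..<a}"
      using prec[OF _ that] that by auto
    finally have "{u \<in> pverts \<Gamma>. prec u (f a)} = f ` {..<a}" .
    moreover have "inj_on f {..<a}" using that by (auto intro!: inj_on_subset[OF inj])
    ultimately show ?thesis by (simp add: card_image)
  qed
  show ?thesis
    unfolding vertex_at_def
  proof (rule the_equality)
    show "f p \<in> pverts \<Gamma> \<and> card {u \<in> pverts \<Gamma>. prec u (f p)} = p"
      using card[OF p] p by (simp add: im)
  next
    fix v assume v: "v \<in> pverts \<Gamma> \<and> card {u \<in> pverts \<Gamma>. prec u v} = p"
    then obtain a where a: "a < N" "v = f a" using im by blast
    with card[OF a(1)] v show "v = f p" by simp
  qed
qed

lemma adjacency_mat_enumeration: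
  assumes "bij_betw f {..<N} (pverts \<Gamma>)"
    and "\<And>a b. a < N \<Longrightarrow> b < N \<Longrightarrow> prec (f a) (f b) \<longleftrightarrow> a < b"
  shows "adjacency_mat \<Gamma> prec = mat N N (\<lambda>(p, q). if (f p, f q) \<in> parcs \<Gamma> then 1 else 0)"
proof -
  have "card (pverts \<Gamma>) = N" using bij_betw_same_card[OF assms(1)] by simp
  then show ?thesis
    unfolding adjacency_mat_def
    by (intro cong_mat) (simp_all add: vertex_at_enumeration[OF assms])
qed

lemma adjacency_mat_cycle_graph:
  "adjacency_mat (cycle_graph m) (<)
    = mat m m (\<lambda>(p, q). if q = Suc p mod m \<or> p = Suc q mod m then 1 else 0)"
proof -
  have bij: "bij_betw id {..<m} (pverts (cycle_graph m))"
    by (simp add: cycle_graph_def)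
  have "adjacency_mat (cycle_graph m) (<)
      = mat m m (\<lambda>(p, q). if (id p, id q) \<in> parcs (cycle_graph m) then 1 else 0)"
    by (rule adjacency_mat_enumeration[OF bij]) simp
  also have "\<dots> = mat m m (\<lambda>(p, q). if q = Suc p mod m \<or> p = Suc q mod m then 1 else 0)"
    by (rule cong_mat[OF refl refl]) (simp add: cycle_graph_def)
  finally show ?thesis .
qed

lemma mult_add_less:
  fixes a p m n :: nat
  assumes "a < n" "p < m" shows "a * m + p < n * m"
proof -
  have "a * m + p < Suc a * m" using assms by simp
  also have "\<dots> \<le> n * m" using assms by (intro mult_le_mono1) simp
  finally show ?thesis .
qed

text \<open>The lexicographic comparison of quotient and remainder serves with divisor \<alpha> for
  the order inside a packet and with divisor \<open>m\<close> for the order of all vertices.\<close>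

lemma less_iff_div_mod:
  "r < s \<longleftrightarrow> r div c < s div c \<or> r div c = s div c \<and> r mod c < s mod c" for r s c :: nat
proof (cases "r div c" "s div c" rule: linorder_cases)
  case less
  then show ?thesis using div_le_mono[of s r c] by fastforce
next
  case equal
  then have "r < s \<longleftrightarrow> r div c * c + r mod c < r div c * c + s mod c"
    by (metis div_mult_mod_eq)
  also have "\<dots> \<longleftrightarrow> r mod c < s mod c"
    by (simp only: add_less_cancel_left)
  finally show ?thesis using equal by simp
next
  case greater
  then show ?thesis using div_le_mono[of r s c] by fastforce
qed

lemma pick_interval:
  assumes "p < l" shows "pick {a ..< a + l} p = a + p"
proof -
  have "{b \<in> {a ..< a + l}. b < a + p} = {a ..< a + p}" using assms by auto
  then show ?thesis using pick_card_in_set[of "a + p" "{a ..< a + l}"] assms by simp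
qed

lemma block_mat:
  assumes "i < n" "j < n"
  shows "block m (mat (n * m) (n * m) f) i j = mat m m (\<lambda>(p, q). f (i * m + p, j * m + q))"
proof -
  \<comment> \<open>The dimensions of a submatrix count only the selected indices inside the matrix;
    here the whole interval lies inside.\<close>
  have rows: "{r. r < n * m \<and> r \<in> {a * m ..< (a + 1) * m}} = {a * m ..< a * m + m}"
    if "a < n" for a
  proof -
    have "Suc a * m \<le> n * m" using that by (intro mult_le_mono1) simp
    then show ?thesis by auto
  qed
  let ?S = "block m (mat (n * m) (n * m) f) i j"
  have "dim_row ?S = m" "dim_col ?S = m"
    using assms by (simp_all only: block_def dim_submatrix dim_row_mat dim_col_mat rows) simp_all
  moreover have "?S $$ (p, q) = f (i * m + p, j * m + q)" if "p < m" "q < m" for p q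
  proof -
    have "?S $$ (p, q) = mat (n * m) (n * m) f
        $$ (pick {i * m ..< (i + 1) * m} p, pick {j * m ..< (j + 1) * m} q)"
      unfolding block_def
      by (rule submatrix_index) (simp_all only: dim_row_mat dim_col_mat rows assms, use that in simp_all)
    also have "\<dots> = f (i * m + p, j * m + q)"
      using mult_add_less[OF assms(1) that(1)] mult_add_less[OF assms(2) that(2)]
        pick_interval[OF that(1), of "i * m"] pick_interval[OF that(2), of "j * m"]
      by (simp add: add.commute[of m])
    finally show ?thesis .
  qed
  ultimately show ?thesis by (intro eq_matI) auto
qed

section \<open>The packet ordering\<close>

context packet_group
begin

section \<open>Powers of \<open>k\<close> modulo \<open>n\<close>\<close>

lemma coprime_k: "coprime k n"
proof -
  have "coprime (k ^ m) n"
    using cong_imp_coprime[OF cong_sym[OF k_pow_m]] by simp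
  then show ?thesis using m_pos by (simp add: coprime_power_left_iff)
qed

abbreviation \<alpha> where "\<alpha> \<equiv> ord n k"

lemma ord_pos: "\<alpha> > 0"
  using coprime_k by (simp add: coprime_commute)

lemma ord_dvd: "\<alpha> dvd m"
  using k_pow_m unfolding ord_divides .

lemma k_pow_cong_iff: "[k ^ a = k ^ b] (mod n) \<longleftrightarrow> [a = b] (mod \<alpha>)"
  by (rule order_divides_expdiff) (simp add: coprime_k coprime_commute)

text \<open>Since \<alpha> divides \<open>m\<close>, reducing the exponent modulo \<open>m\<close>
  is harmless. This is needed where position \<open>m - 1\<close> is followed by position
  \<open>0\<close>.\<close>

lemma k_pow_mod: "[k ^ (a mod m) = k ^ a] (mod n)"
  unfolding k_pow_cong_iff
  by (rule cong_dvd_modulus_nat[OF _ ord_dvd]) (simp add: cong_def)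

section \<open>Vertices indexed by packet and position\<close>

definition vert :: "nat \<Rightarrow> nat \<Rightarrow> gens word set" where
  "vert i p = x [^]\<^bsub>G\<^esub> p \<otimes>\<^bsub>G\<^esub> y [^]\<^bsub>G\<^esub> (i * k ^ p)"

lemma x_pow_y_pow_class: "x [^]\<^bsub>G\<^esub> a \<otimes>\<^bsub>G\<^esub> y [^]\<^bsub>G\<^esub> b
    = word_class R (replicate a (Gen_x, True) @ replicate b (Gen_y, True))" for a b :: nat
  by (simp add: elem_x_def elem_y_def pow_class)

lemma word_act_x_pow_y_pow:
  "word_act (replicate a (Gen_x, True) @ replicate b (Gen_y, True)) (0, 0) = (a mod m, b mod n)"
  using m_pos n_gt_1 by (simp add: word_act_replicate_x word_act_replicate_y)

lemma x_pow_y_pow_eq_iff: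
  "x [^]\<^bsub>G\<^esub> a \<otimes>\<^bsub>G\<^esub> y [^]\<^bsub>G\<^esub> b = x [^]\<^bsub>G\<^esub> c \<otimes>\<^bsub>G\<^esub> y [^]\<^bsub>G\<^esub> d
    \<longleftrightarrow> [a = c] (mod m) \<and> [b = d] (mod n)" for a b c d :: nat
  unfolding x_pow_y_pow_class class_eq_iff word_act_x_pow_y_pow by (simp add: cong_def)

lemma vert_eq_iff:
  assumes "i < n" "j < n" "p < m" "q < m"
  shows "vert i p = vert j q \<longleftrightarrow> i = j \<and> p = q"
proof -
  have "[i * k ^ p = j * k ^ p] (mod n) \<longleftrightarrow> [i = j] (mod n)"
    using coprime_k by (intro cong_mult_rcancel_nat) simp
  moreover have "[i = j] (mod n) \<longleftrightarrow> i = j" "[p = q] (mod m) \<longleftrightarrow> p = q"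
    using assms by (simp_all add: cong_def)
  ultimately show ?thesis
    unfolding vert_def x_pow_y_pow_eq_iff by blast
qed

lemma vert_in [simp]: "vert i p \<in> carrier G"
  by (simp add: vert_def x_pow_y_pow_class)

lemma carrier_G: "carrier G = (\<lambda>(i, p). vert i p) ` ({..<n} \<times> {..<m})"
proof
  show "carrier G \<subseteq> (\<lambda>(i, p). vert i p) ` ({..<n} \<times> {..<m})"
  proof
    fix v assume "v \<in> carrier G"
    then obtain w where w: "v = word_class R w"
      by (auto simp: semidirect_group_def carrier_presented_group)
    obtain a b where ab: "word_act w (0, 0) = (a, b)" by force
    then have lt: "a < m" "b < n" using word_act_in[OF zero_in, of w] by simp_all
    \<comment> \<open>The packet index solves \<open>i * k ^ a = b\<close>; the factor
      \<open>k ^ ((m - 1) * a)\<close> is the inverse of \<open>k ^ a\<close>.\<close>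
    define i where "i = b * k ^ ((m - 1) * a) mod n"
    have "m * a = (m - 1) * a + a"
      using m_pos by (cases m) simp_all
    then have "b * k ^ ((m - 1) * a) * k ^ a = b * (k ^ m) ^ a"
      by (simp only: mult.assoc power_add[symmetric] power_mult[symmetric])
    moreover have "[b * (k ^ m) ^ a = b * 1 ^ a] (mod n)"
      by (intro cong_mult cong_pow cong_refl k_pow_m)
    ultimately have "[b * k ^ ((m - 1) * a) * k ^ a = b] (mod n)"
      by (simp only: power_one mult_1_right)
    then have "[i * k ^ a = b] (mod n)"
      unfolding i_def cong_def mod_mult_left_eq .
    then have "vert i a = v"
      unfolding vert_def w class_normal_form ab
      by (simp add: x_pow_y_pow_eq_iff)
    moreover have "i < n" using n_gt_1 by (simp add: i_def)
    ultimately show "v \<in> (\<lambda>(i, p). vert i p) ` ({..<n} \<times> {..<m})" using lt by force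
  qed
qed auto

lemma enumeration_bij: "bij_betw (\<lambda>r. vert (r div m) (r mod m)) {..<n * m} (carrier G)"
proof -
  have lt: "r div m < n" if "r < n * m" for r
    using that by (simp add: less_mult_imp_div_less)
  have "inj_on (\<lambda>r. vert (r div m) (r mod m)) {..<n * m}"
  proof (rule inj_onI)
    fix r s assume "r \<in> {..<n * m}" "s \<in> {..<n * m}"
      and "vert (r div m) (r mod m) = vert (s div m) (s mod m)"
    then have "r div m = s div m" "r mod m = s mod m"
      using vert_eq_iff[of "r div m" "s div m" "r mod m" "s mod m"] lt m_pos by simp_all
    then show "r = s" by (metis div_mult_mod_eq)
  qed
  moreover have in_range: "vert i p \<in> (\<lambda>r. vert (r div m) (r mod m)) ` {..<n * m}"
    if "i < n" "p < m" for i p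
  proof
    show "vert i p = vert ((i * m + p) div m) ((i * m + p) mod m)" using that by simp
    show "i * m + p \<in> {..<n * m}" using mult_add_less[OF that] by simp
  qed
  have "carrier G \<subseteq> (\<lambda>r. vert (r div m) (r mod m)) ` {..<n * m}"
  proof
    fix v assume "v \<in> carrier G"
    then obtain i p where "i < n" "p < m" "v = vert i p" unfolding carrier_G by blast
    then show "v \<in> (\<lambda>r. vert (r div m) (r mod m)) ` {..<n * m}"
      by (simp only: in_range)
  qed
  moreover have "(\<lambda>r. vert (r div m) (r mod m)) ` {..<n * m} \<subseteq> carrier G"
    using vert_in by blast
  ultimately show ?thesis
    unfolding bij_betw_def by blast
qed

text \<open>\<xi> and the position \<open>\<tau> * \<alpha> + \<xi>\<close> agree modulo \<alpha>,
  so they give the same power of \<open>k\<close>. Hence a vertex can be described by its position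
  alone.\<close>

lemma packet_elem_eq: "packet_elem m n k i \<tau> \<xi> = vert i (\<tau> * \<alpha> + \<xi>)"
proof -
  have "[k ^ \<xi> = k ^ (\<tau> * \<alpha> + \<xi>)] (mod n)"
    unfolding k_pow_cong_iff by (simp add: cong_def)
  then show ?thesis
    by (simp add: packet_elem_def Let_def vert_def x_pow_y_pow_eq_iff cong_scalar_left)
qed

lemma position_lt: "\<tau> < m div \<alpha> \<Longrightarrow> \<xi> < \<alpha> \<Longrightarrow> \<tau> * \<alpha> + \<xi> < m"
  using mult_add_less[of \<tau> "m div \<alpha>" \<xi> \<alpha>] ord_dvd by simp

lemma position_div: "p < m \<Longrightarrow> p div \<alpha> < m div \<alpha>"
  using ord_dvd ord_pos by (simp add: less_mult_imp_div_less)

lemma packet_eq: "packet m n k i = vert i ` {..<m}"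
proof
  show "packet m n k i \<subseteq> vert i ` {..<m}"
    by (auto simp: packet_def packet_elem_eq intro!: imageI position_lt)
  show "vert i ` {..<m} \<subseteq> packet m n k i"
  proof
    fix v assume "v \<in> vert i ` {..<m}"
    then obtain p where p: "v = vert i p" "p < m" by auto
    then have "v = packet_elem m n k i (p div \<alpha>) (p mod \<alpha>)"
      by (simp add: packet_elem_eq div_mult_mod_eq)
    moreover have "p div \<alpha> < m div \<alpha>" "p mod \<alpha> < \<alpha>"
      using p position_div ord_pos by simp_all
    ultimately show "v \<in> packet m n k i" unfolding packet_def by blast
  qed
qed

text \<open>Injectivity of \<open>vert\<close> recovers packet and position from a vertex. The first
  disjunct of \<open>packet_less\<close> then compares packets, and the second compares positions,
  since (\<tau>, \<xi>) are the quotient and remainder of the position by \<alpha>.\<close>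

lemma packet_less_vert:
  assumes "i < n" "j < n" "p < m" "q < m"
  shows "packet_less m n k (vert i p) (vert j q) \<longleftrightarrow> i < j \<or> i = j \<and> p < q"
proof -
  have across: "(\<exists>i'<n. \<exists>j'<n. i' < j' \<and> vert i p \<in> packet m n k i' \<and> vert j q \<in> packet m n k j')
      \<longleftrightarrow> i < j"
    using assms by (auto simp: packet_eq vert_eq_iff)
  have "(\<exists>i'<n. \<exists>\<tau><m div \<alpha>. \<exists>\<tau>'<m div \<alpha>. \<exists>\<xi><\<alpha>. \<exists>\<xi>'<\<alpha>.
      vert i p = packet_elem m n k i' \<tau> \<xi> \<and> vert j q = packet_elem m n k i' \<tau>' \<xi>' \<and>
      (\<tau> < \<tau>' \<or> \<tau> = \<tau>' \<and> \<xi> < \<xi>')) \<longleftrightarrow> i = j \<and> p < q" (is "?L \<longleftrightarrow> _")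
  proof
    assume ?L
    then obtain i' \<tau> \<tau>' \<xi> \<xi>' where lt: "i' < n" "\<tau> < m div \<alpha>" "\<tau>' < m div \<alpha>" "\<xi> < \<alpha>" "\<xi>' < \<alpha>"
      and eq: "vert i p = vert i' (\<tau> * \<alpha> + \<xi>)" "vert j q = vert i' (\<tau>' * \<alpha> + \<xi>')"
      and less: "\<tau> < \<tau>' \<or> \<tau> = \<tau>' \<and> \<xi> < \<xi>'"
      unfolding packet_elem_eq by blast
    have "\<tau> * \<alpha> + \<xi> < \<tau>' * \<alpha> + \<xi>'"
      using less lt by (subst less_iff_div_mod[of _ _ \<alpha>]) simp
    then show "i = j \<and> p < q"
      using eq lt assms by (simp add: vert_eq_iff position_lt)
  next
    assume *: "i = j \<and> p < q"
    have "p div \<alpha> < q div \<alpha> \<or> p div \<alpha> = q div \<alpha> \<and> p mod \<alpha> < q mod \<alpha>"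
      using * less_iff_div_mod by blast
    moreover have "vert i p = packet_elem m n k i (p div \<alpha>) (p mod \<alpha>)"
      "vert j q = packet_elem m n k i (q div \<alpha>) (q mod \<alpha>)"
      using * by (simp_all add: packet_elem_eq div_mult_mod_eq)
    moreover have "p div \<alpha> < m div \<alpha>" "q div \<alpha> < m div \<alpha>" "p mod \<alpha> < \<alpha>" "q mod \<alpha> < \<alpha>"
      using assms ord_pos position_div by auto
    ultimately show ?L using assms by blast
  qed
  with across show ?thesis by (simp only: packet_less_def)
qed

lemma packet_less_enumeration:
  assumes "r < n * m" "s < n * m"
  shows "packet_less m n k (vert (r div m) (r mod m)) (vert (s div m) (s mod m)) \<longleftrightarrow> r < s"
proof -
  have lt: "r div m < n" "s div m < n"
    using assms by (simp_all add: less_mult_imp_div_less)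
  show ?thesis
    using packet_less_vert[OF lt, of "r mod m" "s mod m"] m_pos
    unfolding less_iff_div_mod[of r s m] by simp
qed

section \<open>Arcs of the Cayley graph in packet coordinates\<close>

abbreviation \<Gamma> where "\<Gamma> \<equiv> graph_T m n k"

lemma pverts_graph_T: "pverts \<Gamma> = carrier G"
  by (simp add: graph_T_def cayley_graph_def Let_def)

text \<open>This ties the blocks, which are cut out by index intervals, to the packets.\<close>

lemma vertex_at_packet:
  assumes "i < n"
  shows "vertex_at \<Gamma> (packet_less m n k) ` {i * m ..< (i + 1) * m} = packet m n k i"
proof -
  have "Suc i * m \<le> n * m" using assms by (intro mult_le_mono1) simp
  then have "vertex_at \<Gamma> (packet_less m n k) r = vert i (r - i * m)"
    if "r \<in> {i * m ..< (i + 1) * m}" for r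
  proof -
    have "r < n * m" using that \<open>Suc i * m \<le> n * m\<close> by simp
    then have "vertex_at \<Gamma> (packet_less m n k) r = vert (r div m) (r mod m)"
      using vertex_at_enumeration[of "\<lambda>r. vert (r div m) (r mod m)" "n * m" \<Gamma>]
        enumeration_bij packet_less_enumeration pverts_graph_T by simp
    moreover have "r div m = i"
      using that by (intro div_nat_eqI) (simp_all add: mult.commute)
    moreover from this have "r mod m = r - i * m"
      by (simp add: modulo_nat_def mult.commute)
    ultimately show ?thesis by simp
  qed
  then have "vertex_at \<Gamma> (packet_less m n k) ` {i * m ..< (i + 1) * m}
      = vert i ` (\<lambda>r. r - i * m) ` {i * m ..< (i + 1) * m}"
    by (auto simp: image_image)
  also have "(\<lambda>r. r - i * m) ` {i * m ..< (i + 1) * m} = {..<m}"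
    using image_minus_const_atLeastLessThan_nat[of "i * m" "i * m" "(i + 1) * m"]
    by (simp add: lessThan_atLeast0)
  finally show ?thesis by (simp add: packet_eq)
qed

text \<open>A step along an inverse generator is a step along the generator read backwards, so no
  inverses remain.\<close>

lemma parcs_graph_T:
  assumes "v \<in> carrier G" "w \<in> carrier G"
  shows "(v, w) \<in> parcs \<Gamma> \<longleftrightarrow>
    v \<otimes>\<^bsub>G\<^esub> x = w \<or> w \<otimes>\<^bsub>G\<^esub> x = v \<or> v \<otimes>\<^bsub>G\<^esub> y = w \<or> w \<otimes>\<^bsub>G\<^esub> y = v"
proof -
  interpret G: group G by (rule group_G)
  have inv: "w = v \<otimes>\<^bsub>G\<^esub> inv\<^bsub>G\<^esub> z \<longleftrightarrow> w \<otimes>\<^bsub>G\<^esub> z = v" if "z \<in> carrier G" for z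
    using that assms by (auto simp: G.m_assoc)
  have x: "x \<in> carrier G" and y: "y \<in> carrier G" by (simp_all add: elem_x_def elem_y_def)
  have "(v, w) \<in> parcs \<Gamma> \<longleftrightarrow> (\<exists>s\<in>{x, inv\<^bsub>G\<^esub> x, y, inv\<^bsub>G\<^esub> y}. w = v \<otimes>\<^bsub>G\<^esub> s)"
    using assms(1) by (auto simp: graph_T_def cayley_graph_def Let_def)
  also have "\<dots> \<longleftrightarrow> v \<otimes>\<^bsub>G\<^esub> x = w \<or> w \<otimes>\<^bsub>G\<^esub> x = v \<or> v \<otimes>\<^bsub>G\<^esub> y = w \<or> w \<otimes>\<^bsub>G\<^esub> y = v"
    using inv[OF x] inv[OF y] by auto
  finally show ?thesis .
qed

text \<open>Moving \<open>x\<close> past \<open>y^(i k^p)\<close> turns the exponent into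
  \<open>i k^(p+1)\<close>, which is the one belonging to the next position. The packet index
  \<open>i\<close> is thus preserved, also at the wrap-around.\<close>

lemma vert_mult_x: "vert i p \<otimes>\<^bsub>G\<^esub> x = vert i (Suc p mod m)"
proof -
  interpret G: group G by (rule group_G)
  have x: "x \<in> carrier G" and y: "y \<in> carrier G" by (simp_all add: elem_x_def elem_y_def)
  have "vert i p \<otimes>\<^bsub>G\<^esub> x = x [^]\<^bsub>G\<^esub> Suc p \<otimes>\<^bsub>G\<^esub> y [^]\<^bsub>G\<^esub> (k * (i * k ^ p))"
    unfolding vert_def using x y by (simp add: G.m_assoc y_pow_x)
  also have "\<dots> = vert i (Suc p mod m)"
    using cong_scalar_left[OF cong_sym[OF k_pow_mod[of "Suc p"]], of i]
    unfolding vert_def x_pow_y_pow_eq_iff by (simp add: cong_def mult_ac)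
  finally show ?thesis .
qed

lemma vert_mult_y: "vert i p \<otimes>\<^bsub>G\<^esub> y = x [^]\<^bsub>G\<^esub> p \<otimes>\<^bsub>G\<^esub> y [^]\<^bsub>G\<^esub> Suc (i * k ^ p)"
proof -
  interpret G: group G by (rule group_G)
  have "x \<in> carrier G" "y \<in> carrier G" by (simp_all add: elem_x_def elem_y_def)
  then show ?thesis by (simp add: vert_def G.m_assoc)
qed

text \<open>The condition for packets \<open>i\<close> and \<open>j\<close> to be joined at position
  \<open>p\<close>, with one sign for \<open>y\<close> and one for its inverse. It is stated over
  the integers because \<open>j - i\<close> may be negative.\<close>

definition unit_diff :: "nat \<Rightarrow> nat \<Rightarrow> nat \<Rightarrow> bool" where
  "unit_diff i j p \<longleftrightarrow> [(int j - int i) * int k ^ p = 1] (mod int n)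
    \<or> [(int j - int i) * int k ^ p = - 1] (mod int n)"

lemma vert_mult_y_eq_iff:
  assumes "p < m" "q < m"
  shows "vert i p \<otimes>\<^bsub>G\<^esub> y = vert j q
    \<longleftrightarrow> p = q \<and> [(int j - int i) * int k ^ p = 1] (mod int n)"
proof -
  have "[Suc (i * k ^ p) = j * k ^ p] (mod n)
      \<longleftrightarrow> [int (Suc (i * k ^ p)) = int (j * k ^ p)] (mod int n)"
    by (simp only: cong_int_iff)
  also have "\<dots> \<longleftrightarrow> [(int j - int i) * int k ^ p = 1] (mod int n)"
    by (auto simp: cong_iff_dvd_diff algebra_simps dvd_diff_commute)
  finally have "[Suc (i * k ^ p) = j * k ^ p] (mod n)
      \<longleftrightarrow> [(int j - int i) * int k ^ p = 1] (mod int n)" .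
  moreover have "[p = q] (mod m) \<longleftrightarrow> p = q"
    using assms by (simp add: cong_def)
  ultimately show ?thesis
    unfolding vert_mult_y vert_def[of j] x_pow_y_pow_eq_iff by auto
qed

text \<open>Reading a \<open>y\<close>-arc backwards exchanges \<open>i\<close> and \<open>j\<close>
  and so changes the sign of the difference; the two signs in \<open>unit_diff\<close> account for
  both directions.\<close>

lemma parcs_vert:
  assumes "i < n" "j < n" "p < m" "q < m"
  shows "(vert i p, vert j q) \<in> parcs \<Gamma> \<longleftrightarrow>
    i = j \<and> (q = Suc p mod m \<or> p = Suc q mod m) \<or> p = q \<and> unit_diff i j p"
proof -
  have "[(int i - int j) * int k ^ p = 1] (mod int n) \<longleftrightarrow> [(int j - int i) * int k ^ p = - 1] (mod int n)"
    using cong_minus_minus_iff[of "(int i - int j) * int k ^ p" 1 "int n"]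
    by (simp flip: mult_minus_left)
  then show ?thesis
    using assms m_pos
    by (auto simp: parcs_graph_T vert_mult_x vert_eq_iff vert_mult_y_eq_iff unit_diff_def)
qed

text \<open>For equal packets the product is \<open>0\<close>, which is not congruent to
  \<open>1\<close> or \<open>-1\<close> because \<open>n > 1\<close>. So inside a packet only
  \<open>x\<close> gives arcs, and these form the cycle.\<close>

lemma not_unit_diff_same: "\<not> unit_diff i i p"
  using n_gt_1 by (auto simp: unit_diff_def cong_iff_dvd_diff)

section \<open>Blocks of the adjacency matrix\<close>

definition A where "A = adjacency_mat \<Gamma> (packet_less m n k)"

lemma A_eq: "A = mat (n * m) (n * m)
    (\<lambda>(r, s). if (vert (r div m) (r mod m), vert (s div m) (s mod m)) \<in> parcs \<Gamma> then 1 else 0)"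
  unfolding A_def
  using adjacency_mat_enumeration[of "\<lambda>r. vert (r div m) (r mod m)" "n * m" \<Gamma> "packet_less m n k"]
    enumeration_bij packet_less_enumeration pverts_graph_T by simp

lemma block_A:
  assumes "i < n" "j < n"
  shows "block m A i j = mat m m (\<lambda>(p, q).
    if i = j \<and> (q = Suc p mod m \<or> p = Suc q mod m) \<or> p = q \<and> unit_diff i j p then 1 else 0)"
  unfolding A_eq block_mat[OF assms]
proof (rule cong_mat[OF refl refl], unfold case_prod_conv)
  fix p q assume pq: "p < m" "q < m"
  have "(i * m + p) div m = i" "(i * m + p) mod m = p"
    "(j * m + q) div m = j" "(j * m + q) mod m = q"
    using pq by simp_all
  then show "(if (vert ((i * m + p) div m) ((i * m + p) mod m),
        vert ((j * m + q) div m) ((j * m + q) mod m)) \<in> parcs \<Gamma> then 1 else 0 :: int)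
    = (if i = j \<and> (q = Suc p mod m \<or> p = Suc q mod m) \<or> p = q \<and> unit_diff i j p
      then 1 else 0)"
    by (simp only: parcs_vert[OF assms pq])
qed

lemma block_A_diagonal:
  assumes "i < n"
  shows "block m A i i = adjacency_mat (cycle_graph m) (<)"
  unfolding block_A[OF assms assms] adjacency_mat_cycle_graph
  by (rule cong_mat[OF refl refl]) (simp_all add: not_unit_diff_same)

lemma block_A_off_diagonal:
  assumes "i < n" "j < n" "i \<noteq> j"
  shows "block m A i j = Diag m {p. p < m \<and> unit_diff i j p}"
  unfolding block_A[OF assms(1,2)] Diag_def
  by (rule cong_mat[OF refl refl]) (auto simp: assms(3))

text \<open>The entries of a block depend only on whether \<open>i = j\<close> and on
  \<open>j - i\<close> modulo \<open>n\<close>; a simultaneous cyclic shift preserves both.\<close>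

lemma block_circulant_A: "block_circulant m n A"
  unfolding block_circulant_def
proof (intro allI impI)
  fix i j assume lt: "i < n" "j < n"
  have lt': "(i + 1) mod n < n" "(j + 1) mod n < n" using n_gt_1 by simp_all
  have "(i + 1) mod n = (j + 1) mod n \<longleftrightarrow> [i + 1 = j + 1] (mod n)"
    by (simp add: cong_def)
  also have "\<dots> \<longleftrightarrow> i = j"
    unfolding cong_add_rcancel_nat using lt by (simp add: cong_def)
  finally have eq: "(i + 1) mod n = (j + 1) mod n \<longleftrightarrow> i = j" .
  have "[int ((j + 1) mod n) - int ((i + 1) mod n) = int (j + 1) - int (i + 1)] (mod int n)"
    by (intro cong_diff) (simp_all add: zmod_int cong_def)
  then have "[int ((j + 1) mod n) - int ((i + 1) mod n) = int j - int i] (mod int n)"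
    by simp
  then have "[(int ((j + 1) mod n) - int ((i + 1) mod n)) * int k ^ p
      = (int j - int i) * int k ^ p] (mod int n)" for p
    by (rule cong_scalar_right)
  then have "unit_diff ((i + 1) mod n) ((j + 1) mod n) p \<longleftrightarrow> unit_diff i j p" for p
    unfolding unit_diff_def cong_def by simp
  then show "block m A i j = block m A ((i + 1) mod n) ((j + 1) mod n)"
    unfolding block_A[OF lt] block_A[OF lt'] eq by simp
qed

end

section \<open>The off-diagonal blocks\<close>

lemma nonzero_entries_Diag:
  assumes "P \<subseteq> {..<m}" shows "card (nonzero_entries (Diag m P)) = card P"
proof -
  have "nonzero_entries (Diag m P) = (\<lambda>p. (p, p)) ` P"
    using assms by (auto simp: nonzero_entries_def Diag_def split: if_splits)
  then show ?thesis by (simp add: card_image inj_on_def)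
qed

lemma diagonal_mat_Diag: "diagonal_mat (Diag m P)"
  by (simp add: diagonal_mat_def Diag_def)

lemma Diag_empty: "Diag m {} = 0\<^sub>m m m"
  by (auto simp: Diag_def intro!: eq_matI)

lemma card_progression: "h > 0 \<Longrightarrow> card {\<xi> + s * h | s. s < c} = c" for \<xi> h c :: nat
proof -
  assume "h > 0"
  have "{\<xi> + s * h | s. s < c} = (\<lambda>s. \<xi> + s * h) ` {..<c}" by auto
  then show ?thesis using \<open>h > 0\<close> by (simp add: card_image inj_on_def)
qed

text \<open>If \<open>h\<close> divides \<open>a - b\<close>, an even quotient gives the first
  congruence modulo \<open>2 * h\<close> and an odd quotient the second.\<close>

lemma cong_half_modulus:
  "[a = b] (mod 2 * h) \<or> [a = b + h] (mod 2 * h) \<longleftrightarrow> [a = b] (mod h)" for a b h :: nat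
proof
  assume "[a = b] (mod h)"
  then have "int h dvd int a - int b" by (simp flip: cong_int_iff add: cong_iff_dvd_diff)
  then obtain z where z: "int a - int b = int h * z" by (auto elim: dvdE)
  show "[a = b] (mod 2 * h) \<or> [a = b + h] (mod 2 * h)"
  proof (cases "even z")
    case True
    then obtain w where "z = 2 * w" by (auto elim: evenE)
    with z have "int a - int b = int (2 * h) * w" by simp
    then have "[int a = int b] (mod int (2 * h))" by (simp only: cong_iff_dvd_diff dvd_triv_left)
    then show ?thesis unfolding cong_int_iff by blast
  next
    case False
    then obtain w where "z = 2 * w + 1" by (auto elim: oddE)
    with z have "int a - int (b + h) = int (2 * h) * w" by (simp add: algebra_simps)
    then have "[int a = int (b + h)] (mod int (2 * h))" by (simp only: cong_iff_dvd_diff dvd_triv_left)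
    then show ?thesis unfolding cong_int_iff by blast
  qed
next
  assume "[a = b] (mod 2 * h) \<or> [a = b + h] (mod 2 * h)"
  then have "[a = b] (mod h) \<or> [a = b + h] (mod h)"
    using cong_dvd_modulus_nat dvd_triv_right by blast
  then show "[a = b] (mod h)" by (simp add: cong_def)
qed

context packet_group
begin

section \<open>Nonzero positions of an off-diagonal block\<close>

lemma int_k_pow_cong_iff: "[int k ^ a = int k ^ b] (mod int n) \<longleftrightarrow> [a = b] (mod \<alpha>)"
  using k_pow_cong_iff by (simp flip: cong_int_iff of_nat_power)

lemma unit_diff_iff: "unit_diff i j p
    \<longleftrightarrow> (\<exists>e\<in>{1, - 1}. [(int j - int i) * int k ^ p = e] (mod int n))"
  by (simp add: unit_diff_def)

text \<open>Multiplying by \<open>k ^ (\<alpha> - \<xi>)\<close>, the inverse of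
  \<open>k ^ \<xi>\<close>, solves \<open>(j - i) * k ^ \<xi> = e\<close> for \<open>j\<close>, for
  either sign \<open>e\<close>.\<close>

lemma unit_diff_iff_neighbour:
  assumes "\<xi> \<le> \<alpha>"
  shows "unit_diff i j \<xi> \<longleftrightarrow> [int j = int i + int k ^ (\<alpha> - \<xi>)] (mod int n)
    \<or> [int j = int i - int k ^ (\<alpha> - \<xi>)] (mod int n)"
proof -
  have "int k ^ (\<alpha> - \<xi>) * int k ^ \<xi> = int k ^ \<alpha>"
    using assms by (simp flip: power_add)
  moreover have "[int k ^ \<alpha> = int k ^ 0] (mod int n)"
    unfolding int_k_pow_cong_iff by (simp add: cong_def)
  ultimately have one: "[int k ^ (\<alpha> - \<xi>) * int k ^ \<xi> = 1] (mod int n)" by simp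
  have cop: "coprime (int k ^ \<xi>) (int n)" using coprime_k by simp
  have "[(int j - int i) * int k ^ \<xi> = e] (mod int n)
      \<longleftrightarrow> [int j = int i + e * int k ^ (\<alpha> - \<xi>)] (mod int n)" for e
  proof -
    have "[int j = int i + e * int k ^ (\<alpha> - \<xi>)] (mod int n)
        \<longleftrightarrow> [int j - int i = e * int k ^ (\<alpha> - \<xi>)] (mod int n)"
      by (simp add: cong_iff_dvd_diff algebra_simps)
    also have "\<dots> \<longleftrightarrow> [(int j - int i) * int k ^ \<xi> = e * int k ^ (\<alpha> - \<xi>) * int k ^ \<xi>] (mod int n)"
      using cong_mult_rcancel[OF cop] by blast
    also have "\<dots> \<longleftrightarrow> [(int j - int i) * int k ^ \<xi> = e] (mod int n)"
      using cong_scalar_left[OF one, of e] by (simp only: cong_def mult.assoc mult_1_right)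
    finally show ?thesis by simp
  qed
  from this[of 1] this[of "- 1"] show ?thesis by (simp add: unit_diff_def)
qed

text \<open>If \<open>(j - i) * k ^ \<xi> = e\<close> with a sign \<open>e\<close>, then
  \<open>(j - i) * k ^ p = f\<close> is equivalent to \<open>k ^ p = e * f * k ^ \<xi>\<close>. As
  \<open>f\<close> runs through both signs, so does \<open>e * f\<close>.\<close>

lemma unit_diff_transfer:
  assumes "unit_diff i j \<xi>"
  shows "unit_diff i j p \<longleftrightarrow>
    [int k ^ p = int k ^ \<xi>] (mod int n) \<or> [int k ^ p = - (int k ^ \<xi>)] (mod int n)"
proof -
  let ?d = "int j - int i"
  obtain e where e: "e = 1 \<or> e = - 1" and d: "[?d * int k ^ \<xi> = e] (mod int n)"
    using assms by (auto simp: unit_diff_iff)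
  have ee: "e * e = 1" using e by auto
  have "[?d * int k ^ p = f] (mod int n) \<longleftrightarrow> [int k ^ p = e * f * int k ^ \<xi>] (mod int n)" for f
  proof
    assume "[?d * int k ^ p = f] (mod int n)"
    then have f: "[e * (?d * int k ^ p) * int k ^ \<xi> = e * f * int k ^ \<xi>] (mod int n)"
      by (intro cong_mult cong_refl)
    \<comment> \<open>The factor \<open>e * e = 1\<close> is inserted so that one of the two
      \<open>e\<close> can be replaced by \<open>(j - i) * k ^ \<xi>\<close>.\<close>
    have "int k ^ p = e * int k ^ p * e"
      using ee by (simp add: mult.assoc mult.left_commute)
    also have "[\<dots> = e * int k ^ p * (?d * int k ^ \<xi>)] (mod int n)"
      by (rule cong_scalar_left[OF cong_sym[OF d]])
    also have "e * int k ^ p * (?d * int k ^ \<xi>) = e * (?d * int k ^ p) * int k ^ \<xi>"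
      by (simp only: mult_ac)
    also note f
    finally show "[int k ^ p = e * f * int k ^ \<xi>] (mod int n)" .
  next
    assume "[int k ^ p = e * f * int k ^ \<xi>] (mod int n)"
    then have "[?d * int k ^ p = ?d * (e * f * int k ^ \<xi>)] (mod int n)"
      by (rule cong_scalar_left)
    also have "?d * (e * f * int k ^ \<xi>) = e * f * (?d * int k ^ \<xi>)"
      by (simp only: mult_ac)
    also have "[\<dots> = e * f * e] (mod int n)"
      by (rule cong_scalar_left[OF d])
    also have "e * f * e = f" using ee by (simp add: mult.assoc mult.left_commute)
    finally show "[?d * int k ^ p = f] (mod int n)" .
  qed
  then show ?thesis using e by (auto simp: unit_diff_def)
qed

text \<open>The assumption on \<open>h\<close> says that a power of \<open>k\<close>, up to sign,
  determines its exponent exactly modulo \<open>h\<close>. The positions therefore form the residue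
  class of \<xi> modulo \<open>h\<close>, which has \<open>c\<close> members below
  \<open>m = h * c\<close>.\<close>

lemma unit_diff_positions:
  assumes h: "\<And>a b. [int k ^ a = int k ^ b] (mod int n) \<or> [int k ^ a = - (int k ^ b)] (mod int n)
      \<longleftrightarrow> [a = b] (mod h)"
    and "m = h * c" and "\<xi> < h" and \<xi>: "unit_diff i j \<xi>"
  shows "{p. p < m \<and> unit_diff i j p} = {\<xi> + s * h | s. s < c}"
proof -
  have "unit_diff i j p \<longleftrightarrow> p mod h = \<xi>" for p
    unfolding unit_diff_transfer[OF \<xi>] h using \<open>\<xi> < h\<close> by (simp add: cong_def)
  moreover have "p < m \<and> p mod h = \<xi> \<longleftrightarrow> (\<exists>s<c. p = \<xi> + s * h)" for p
  proof
    assume p: "p < m \<and> p mod h = \<xi>"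
    then have "p div h < c" using assms(2) by (simp add: less_mult_imp_div_less mult.commute)
    moreover have "p = \<xi> + p div h * h" using p mod_div_mult_eq[of p h] by simp
    ultimately show "\<exists>s<c. p = \<xi> + s * h" by blast
  next
    assume "\<exists>s<c. p = \<xi> + s * h"
    then obtain s where "s < c" and p: "p = \<xi> + s * h" by blast
    then have "p < m"
      using mult_add_less[OF \<open>s < c\<close> \<open>\<xi> < h\<close>] assms(2) by (simp only: add.commute mult.commute)
    then show "p < m \<and> p mod h = \<xi>" using p \<open>\<xi> < h\<close> by simp
  qed
  ultimately show ?thesis by blast
qed

text \<open>Any solution could be reduced modulo \<open>h\<close> to one below \<open>h\<close>, so
  it suffices to exclude those.\<close>

lemma no_unit_diff_positions:
  assumes h: "\<And>a b. [int k ^ a = int k ^ b] (mod int n) \<or> [int k ^ a = - (int k ^ b)] (mod int n)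
      \<longleftrightarrow> [a = b] (mod h)"
    and "h > 0" and no: "\<nexists>\<xi>. \<xi> < h \<and> unit_diff i j \<xi>"
  shows "{p. p < m \<and> unit_diff i j p} = {}"
proof -
  have "unit_diff i j (p mod h)" if "unit_diff i j p" for p
    unfolding unit_diff_transfer[OF that] h by (simp add: cong_def)
  moreover have "p mod h < h" for p using \<open>h > 0\<close> by simp
  ultimately show ?thesis using no by blast
qed

text \<open>Dividing \<open>k ^ a = - (k ^ b)\<close> by \<open>k ^ b\<close> would make
  \<open>-1\<close> a power of \<open>k\<close>, so the negative sign never occurs.\<close>

lemma signed_power_cong_full:
  assumes "\<forall>s::nat. \<not> [int k ^ s = - 1] (mod int n)"
  shows "[int k ^ a = int k ^ b] (mod int n) \<or> [int k ^ a = - (int k ^ b)] (mod int n)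
    \<longleftrightarrow> [a = b] (mod \<alpha>)"
proof -
  have "\<not> [int k ^ a = - (int k ^ b)] (mod int n)"
  proof
    assume "[int k ^ a = - (int k ^ b)] (mod int n)"
    \<comment> \<open>The factor \<open>k ^ ((\<alpha> - 1) * b)\<close> is the inverse of
      \<open>k ^ b\<close>.\<close>
    then have "[int k ^ a * int k ^ ((\<alpha> - 1) * b) = - (int k ^ b) * int k ^ ((\<alpha> - 1) * b)] (mod int n)"
      by (rule cong_scalar_right)
    moreover have "b + (\<alpha> - 1) * b = \<alpha> * b"
      using ord_pos by (cases \<alpha>) simp_all
    ultimately have "[int k ^ (a + (\<alpha> - 1) * b) = - (int k ^ (\<alpha> * b))] (mod int n)"
      by (simp flip: power_add)
    also have "[- (int k ^ (\<alpha> * b)) = - (int k ^ 0)] (mod int n)"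
      unfolding cong_minus_minus_iff int_k_pow_cong_iff by (simp add: cong_def)
    finally have "[int k ^ (a + (\<alpha> - 1) * b) = - 1] (mod int n)"
      by simp
    then show False using assms by blast
  qed
  then show ?thesis by (simp add: int_k_pow_cong_iff)
qed

text \<open>The sign is absorbed by adding \<open>\<alpha> div 2\<close> to the exponent, and the
  resulting two residue classes modulo \<alpha> form one class modulo
  \<open>\<alpha> div 2\<close>.\<close>

lemma signed_power_cong_half:
  assumes "even \<alpha>" and half: "[int k ^ (\<alpha> div 2) = - 1] (mod int n)"
  shows "[int k ^ a = int k ^ b] (mod int n) \<or> [int k ^ a = - (int k ^ b)] (mod int n)
    \<longleftrightarrow> [a = b] (mod \<alpha> div 2)"
proof -
  have "[int k ^ (b + \<alpha> div 2) = - (int k ^ b)] (mod int n)"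
    using cong_scalar_left[OF half, of "int k ^ b"] by (simp add: power_add)
  then have "[int k ^ a = - (int k ^ b)] (mod int n) \<longleftrightarrow> [int k ^ a = int k ^ (b + \<alpha> div 2)] (mod int n)"
    by (simp only: cong_def)
  then show ?thesis
    using cong_half_modulus[of a b "\<alpha> div 2"] \<open>even \<alpha>\<close> by (simp add: int_k_pow_cong_iff)
qed

text \<open>It shows that the two cases are exhaustive. From \<open>k ^ (2 * s) = 1\<close> the
  order divides \<open>2 * s\<close>. The quotient is odd, as otherwise \<open>k ^ s\<close> would
  be both \<open>1\<close> and \<open>-1\<close>, which \<open>n > 2\<close> forbids. So \<alpha> is
  even and \<open>s\<close> is congruent to \<open>\<alpha> div 2\<close> modulo \<alpha>.\<close>

lemma half_order_minus_one:
  assumes "n > 2" and s: "[int k ^ s = - 1] (mod int n)"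
  shows "even \<alpha> \<and> [int k ^ (\<alpha> div 2) = - 1] (mod int n)"
proof -
  have "[int k ^ s * int k ^ s = - 1 * - 1] (mod int n)"
    by (rule cong_mult[OF s s])
  then have "[int k ^ (2 * s) = int k ^ 0] (mod int n)"
    by (simp add: mult_2 power_add)
  then have "\<alpha> dvd 2 * s"
    unfolding int_k_pow_cong_iff by (simp add: cong_0_iff)
  then obtain c where c: "2 * s = \<alpha> * c" by (auto elim: dvdE)
  have "odd c"
  proof
    assume "even c"
    then have "\<alpha> dvd s" using c by (auto elim!: evenE)
    then have "[int k ^ s = int k ^ 0] (mod int n)"
      unfolding int_k_pow_cong_iff by (simp add: cong_0_iff)
    with s have "[1 = - 1] (mod int n)" by (simp add: cong_def)
    then have "int n dvd 2" by (simp add: cong_iff_dvd_diff)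
    then show False using \<open>n > 2\<close> zdvd_imp_le by fastforce
  qed
  then have even: "even \<alpha>" using c by (metis dvd_triv_left even_mult_iff)
  obtain d where d: "c = 2 * d + 1" using \<open>odd c\<close> by (auto elim: oddE)
  have "s = \<alpha> div 2 + \<alpha> * d" using c d even by (auto elim!: evenE)
  then have "[\<alpha> div 2 = s] (mod \<alpha>)" by (simp add: cong_def)
  then have "[int k ^ (\<alpha> div 2) = int k ^ s] (mod int n)" by (simp add: int_k_pow_cong_iff)
  with s even show ?thesis using cong_trans by blast
qed

text \<open>Case (i) is \<open>h = \<alpha>\<close>, \<open>c = t\<close>; case (ii) is \<open>h = \<alpha> / 2\<close>, \<open>c = 2t\<close>.\<close>

lemma block_A_cases:
  assumes "\<And>a b. [int k ^ a = int k ^ b] (mod int n) \<or> [int k ^ a = - (int k ^ b)] (mod int n)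
      \<longleftrightarrow> [a = b] (mod h)"
    and "m = h * c" and "h \<le> \<alpha>" and "i < n" "j < n" "i \<noteq> j"
  shows "\<And>\<xi>. \<xi> < h \<Longrightarrow> [int j = int i + int k ^ (\<alpha> - \<xi>)] (mod int n)
      \<or> [int j = int i - int k ^ (\<alpha> - \<xi>)] (mod int n) \<Longrightarrow>
      block m A i j = Diag m {\<xi> + s * h | s. s < c}"
    and "\<nexists>\<xi>. \<xi> < h \<and> ([int j = int i + int k ^ (\<alpha> - \<xi>)] (mod int n)
      \<or> [int j = int i - int k ^ (\<alpha> - \<xi>)] (mod int n)) \<Longrightarrow> block m A i j = 0\<^sub>m m m"
    and "diagonal_mat (block m A i j) \<and> card (nonzero_entries (block m A i j)) \<in> {0, c}"
proof -
  let ?P = "{p. p < m \<and> unit_diff i j p}"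
  have block: "block m A i j = Diag m ?P" by (rule block_A_off_diagonal[OF assms(4-6)])
  have h: "h > 0" using m_pos assms(2) by (cases h) simp_all
  have unit: "unit_diff i j \<xi> \<longleftrightarrow> [int j = int i + int k ^ (\<alpha> - \<xi>)] (mod int n)
      \<or> [int j = int i - int k ^ (\<alpha> - \<xi>)] (mod int n)" if "\<xi> < h" for \<xi>
    using that assms(3) by (intro unit_diff_iff_neighbour) simp
  show "block m A i j = Diag m {\<xi> + s * h | s. s < c}"
    if "\<xi> < h" "[int j = int i + int k ^ (\<alpha> - \<xi>)] (mod int n)
      \<or> [int j = int i - int k ^ (\<alpha> - \<xi>)] (mod int n)" for \<xi>
    using unit_diff_positions[OF assms(1,2) that(1)] unit that block by simp
  show "block m A i j = 0\<^sub>m m m"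
    if "\<nexists>\<xi>. \<xi> < h \<and> ([int j = int i + int k ^ (\<alpha> - \<xi>)] (mod int n)
      \<or> [int j = int i - int k ^ (\<alpha> - \<xi>)] (mod int n))"
    using no_unit_diff_positions[OF assms(1) h, of i j] unit that block Diag_empty by metis
  have "card ?P \<in> {0, c}"
  proof (cases "\<exists>\<xi><h. unit_diff i j \<xi>")
    case True
    then obtain \<xi> where "\<xi> < h" "unit_diff i j \<xi>" by blast
    from unit_diff_positions[OF assms(1,2) this] show ?thesis
      using card_progression[OF h] by simp
  next
    case False
    then have "?P = {}" by (intro no_unit_diff_positions[OF assms(1) h]) blast
    then show ?thesis by (metis card.empty insertI1)
  qed
  moreover have "?P \<subseteq> {..<m}" by auto
  ultimately show "diagonal_mat (block m A i j) \<and> card (nonzero_entries (block m A i j)) \<in> {0, c}"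
    unfolding block by (simp add: diagonal_mat_Diag nonzero_entries_Diag)
qed

end

theorem theorem1:
  fixes m n k \<alpha> t :: nat and A :: "int mat"
  assumes "m \<ge> 3" and "n \<ge> 3"
    and "coprime k n" and "[k ^ m = 1] (mod n)"
    and "\<alpha> = ord n k" and "t = m div \<alpha>"
    and "A = adjacency_mat (graph_T m n k) (packet_less m n k)"
  shows "A \<in> carrier_mat (n * m) (n * m)
    \<and> (\<forall>i < n. vertex_at (graph_T m n k) (packet_less m n k) ` {i * m ..< (i + 1) * m}
          = packet m n k i)
    \<and> block_circulant m n A
    \<and> (\<forall>i < n. block m A i i = adjacency_mat (cycle_graph m) (<))
    \<and> (\<forall>i < n. \<forall>j < n. j \<noteq> i \<longrightarrow>
          diagonal_mat (block m A i j) \<and> card (nonzero_entries (block m A i j)) \<in> {0, t, 2 * t})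
    \<and> ((\<forall>s::nat. \<not> [int k ^ s = - 1] (mod int n)) \<longrightarrow>
        (\<forall>i < n. \<forall>j < n. j \<noteq> i \<longrightarrow>
          (\<forall>\<xi> < \<alpha>. [int j = int i + int k ^ (\<alpha> - \<xi>)] (mod int n)
                 \<or> [int j = int i - int k ^ (\<alpha> - \<xi>)] (mod int n) \<longrightarrow>
             block m A i j = Diag m {\<xi> + s * \<alpha> | s. s < t})
          \<and> ((\<nexists>\<xi>. \<xi> < \<alpha> \<and> ([int j = int i + int k ^ (\<alpha> - \<xi>)] (mod int n)
                          \<or> [int j = int i - int k ^ (\<alpha> - \<xi>)] (mod int n))) \<longrightarrow>
             block m A i j = 0\<^sub>m m m)))
    \<and> (even \<alpha> \<and> [int k ^ (\<alpha> div 2) = - 1] (mod int n) \<longrightarrow>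
        (\<forall>i < n. \<forall>j < n. j \<noteq> i \<longrightarrow>
          (\<forall>\<xi> < \<alpha> div 2. [int j = int i + int k ^ (\<alpha> - \<xi>)] (mod int n)
                       \<or> [int j = int i - int k ^ (\<alpha> - \<xi>)] (mod int n) \<longrightarrow>
             block m A i j = Diag m {\<xi> + s * (\<alpha> div 2) | s. s < 2 * t})
          \<and> ((\<nexists>\<xi>. \<xi> < \<alpha> div 2 \<and> ([int j = int i + int k ^ (\<alpha> - \<xi>)] (mod int n)
                                \<or> [int j = int i - int k ^ (\<alpha> - \<xi>)] (mod int n))) \<longrightarrow>
             block m A i j = 0\<^sub>m m m)))"
proof -
  interpret P: packet_group m n k
    using assms(1,2,4) by unfold_locales simp_all
  have A: "A = P.A" using assms(7) by (simp add: P.A_def)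
  have m: "m = ord n k * t" using P.ord_dvd assms(5,6) by simp
  note full = P.block_A_cases[OF P.signed_power_cong_full m order_refl]
  have m_half: "m = ord n k div 2 * (2 * t)" if "even (ord n k)" using m that by (auto elim: evenE)
  note half = P.block_A_cases[OF P.signed_power_cong_half m_half div_le_dividend]
  have off_diagonal: "diagonal_mat (block m A i j)
      \<and> card (nonzero_entries (block m A i j)) \<in> {0, t, 2 * t}"
    if "i < n" "j < n" "j \<noteq> i" for i j
  \<comment> \<open>If \<open>-1\<close> is not a power of \<open>k\<close>, a block has
    \<open>0\<close> or \<open>t\<close> nonzero entries; otherwise
    \<open>half_order_minus_one\<close> leads to the half period and to \<open>0\<close> or
    \<open>2 * t\<close>.\<close>
  proof (cases "\<forall>s::nat. \<not> [int k ^ s = - 1] (mod int n)")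
    case True
    from full(3)[OF this that(1,2)] that(3) show ?thesis unfolding A by auto
  next
    case False
    then have "even (ord n k)" "[int k ^ (ord n k div 2) = - 1] (mod int n)"
      using P.half_order_minus_one assms(2) by auto
    from half(3)[OF this this(1) that(1,2)] that(3) show ?thesis unfolding A by auto
  qed
  show ?thesis
    unfolding assms(5)
  proof (intro conjI allI impI, goal_cases)
    case 1
    show ?case unfolding A P.A_eq by simp
  next
    case (2 i)
    then show ?case by (rule P.vertex_at_packet)
  next
    case 3
    show ?case unfolding A by (rule P.block_circulant_A)
  next
    case (4 i)
    then show ?case unfolding A by (rule P.block_A_diagonal)
  next
    case (5 i j)
    then show ?case using off_diagonal by blast
  next
    case (6 i j)
    then show ?case using off_diagonal by blast
  next
    case (7 i j \<xi>)
    then show ?case unfolding A by (intro full(1)) auto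
  next
    case (8 i j)
    then show ?case unfolding A by (intro full(2)) auto
  next
    case (9 i j \<xi>)
    then show ?case unfolding A by (intro half(1)) auto
  next
    case (10 i j)
    then show ?case unfolding A by (intro half(2)) auto
  qed
qed

end
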